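(* Let $F>0$ and suppose that $$\phi''_{F}>0,\ \phi''_{2F}<0,\quad \rho'_{F}\le 0,\ \rho'_{2F}\le 0,\quad \rho''_{F}\ge 0,\ \rho''_{2F}\ge 0,\quad G''_{F}\ge 0.$$ Then the relation between the stability of the reconstruction-based local model and the atomistic model depends on the sign of $\phi''_{2F}+2G'_F\rho''_{2F}$ and is given by (i) $\displaystyle\min_{0\le s\le4}\lambda^a_F(s)=\lambda^a_F(4)<\min_{0\le s\le4}\lambda^{c,r}_F(s)$ if $\phi''_{2F}+2G'_F\rho''_{2F}>0$; (ii) $\displaystyle\min_{0\le s\le4}\lambda^a_F(s)=\min\{\lambda^a_F(0),\lambda^a_F(s^* ),\lambda^a_F(4)\}=\min_{0\le s\le4}\lambda^{c,r}_F(s)$ if $\phi''_{2F}+2G'_F\rho''_{2F}=0$; (iii) $\displaystyle\min_{0\le s\le4}\lambda^a_F(s)=\min\{\lambda^a_F(0),\lambda^a_F(s^* ),\lambda^a_F(4)\}>\min_{0\le s\le4}\lambda^{c,r}_F(s)$ if $\phi''_{2F}+2G'_F\rho''_{2F}<0$.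
   Context: Fix smooth functions $\phi,\rho:(0,\infty)\to\mathbb{R}$ (pair potential, electron density), $G:\mathbb{R}\to\mathbb{R}$ (embedding function), and $F>0$. Notation: $\phi''_F=\phi''(F)$, $\phi''_{2F}=\phi''(2F)$, $\rho'_F=\rho'(F)$, $\rho'_{2F}=\rho'(2F)$, $\rho''_F=\rho''(F)$, $\rho''_{2F}=\rho''(2F)$, and $G'_F=G'(\bar\rho_F)$, $G''_F=G''(\bar\rho_F)$ with $\bar\rho_F=2\rho(F)+2\rho(2F)$. Put $$A_F=4G''_F(\rho'_F+2\rho'_{2F})^2+2G'_F(\rho''_F+4\rho''_{2F})+\phi''_F+4\phi''_{2F},$$ $$B_F=-\big[\phi''_{2F}+G''_F\big((\rho'_F)^2+20(\rho'_{2F})^2+12\rho'_F\rho'_{2F}\big)+2G'_F\rho''_{2F}\big],\qquad \tilde B_F=-G''_F(\rho'_F+2\rho'_{2F})^2,$$ $$C_F=G''_F\big(8(\rho'_{2F})^2+2\rho'_F\rho'_{2F}\big),\qquad D_F=-G''_F(\rho'_{2F})^2.$$ The sign assumptions are regarded as giving $C_F>0$ and $D_F<0$. The eigenvalue functions are, for $s\in[0,4]$, $\lambda^a_F(s)=A_F+B_Fs+C_Fs^2+D_Fs^3$ (atomistic) and $\lambda^{c,r}_F(s)=A_F+\tilde B_Fs$ (reconstruction-based local). The point $$s^*=\frac{C_F-\sqrt{C_F^2-3B_FD_F}}{-3D_F}$$ is the critical point of the cubic $\lambda^a_F$ at which it has its local minimum; it exists when $C_F^2-3B_FD_F\ge0$,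 equivalently $\phi''_{2F}+2G'_F\rho''_{2F}\le\frac13G''_F(\rho'_F-2\rho'_{2F})^2$, which holds in cases (ii) and (iii). Interpretation: for a $2N$-periodic chain with spacing $\epsilon=1/N$, uniform deformation $(\mathbf{y}_F)_\ell=F\epsilon\ell$, $y'_\ell=(y_\ell-y_{\ell-1})/\epsilon$, the numbers $\lambda^a_F(s_k)$ and $\lambda^{c,r}_F(s_k)$, $s_k=4\sin^2(k\pi/(2N))$, $k=1,\dots,N$, are the eigenvalues, with respect to the norm $(\epsilon\sum_{\ell=-N+1}^N|u'_\ell|^2)^{1/2}$ on $2N$-periodic mean-zero displacements $\mathbf{u}$, of the second variations at $\mathbf{y}_F$ of the atomistic energy $\mathcal{E}^a(\mathbf{y})=\epsilon\sum_{\ell=-N+1}^N\{G(\rho(y'_\ell)+\rho(y'_\ell+y'_{\ell-1})+\rho(y'_{\ell+1})+\rho(y'_{\ell+1}+y'_{\ell+2}))+\frac12[\phi(y'_\ell)+\phi(y'_\ell+y'_{\ell-1})+\phi(y'_{\ell+1})+\phi(y'_{\ell+1}+y'_{\ell+2})]\}$ and of the reconstruction-based local energy $\mathcal{E}^{c,r}(\mathbf{y})=\epsilon\sum_{\ell=-N+1}^N\{G(\rho(y'_\ell)+\rho(2y'_\ell)+\rho(y'_{\ell+1})+\rho(2y'_{\ell+1}))+\frac12[\phi(y'_\ell)+\phi(2y'_\ell)+\phi(y'_{\ell+1})+\phi(2y'_{\ell+1})]\}$, respectively. The number $N$ is assumed sufficiently large, and the minimum over $0\le s\le4$ is used to approximate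 the minimum over the $s_k$.
   Formalization: In (ii) and (iii) the term λ^a_F(s* ) is included in the minimum only when s* lies in [0,4]; otherwise the printed formula fails, e.g. in (ii) if ρ'_F/ρ'_{2F} > 2, where s* > 4. C_F > 0 and D_F < 0 are assumed explicitly. *)

theory Defs
  imports "HOL-Analysis.Analysis"
begin

text \<open>Smoothness on an \<^emph>\<open>open\<close> set. Since \<open>deriv\<close> at a point of \<open>S\<close> only depends on the
  function near that point, the values of \<open>f\<close> outside \<open>S\<close> are irrelevant; this is how functions
  \<open>(0,\<infinity>) \<rightarrow> \<real>\<close> are represented by total functions below.\<close>

definition smooth_on_open :: "real set \<Rightarrow> (real \<Rightarrow> real) \<Rightarrow> bool" where
  "smooth_on_open S f \<longleftrightarrow> open S \<and> (\<forall>k. \<forall>x\<in>S. ((deriv ^^ k) f) differentiable (at x))"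

abbreviation deriv2 :: "(real \<Rightarrow> real) \<Rightarrow> real \<Rightarrow> real" where
  "deriv2 f \<equiv> deriv (deriv f)"

definition rho_bar :: "(real \<Rightarrow> real) \<Rightarrow> real \<Rightarrow> real" where
  "rho_bar \<rho> F = 2 * \<rho> F + 2 * \<rho> (2 * F)"

definition coeff_A :: "(real \<Rightarrow> real) \<Rightarrow> (real \<Rightarrow> real) \<Rightarrow> (real \<Rightarrow> real) \<Rightarrow> real \<Rightarrow> real" where
  "coeff_A \<phi> \<rho> G F =
     4 * deriv2 G (rho_bar \<rho> F) * (deriv \<rho> F + 2 * deriv \<rho> (2 * F))\<^sup>2
     + 2 * deriv G (rho_bar \<rho> F) * (deriv2 \<rho> F + 4 * deriv2 \<rho> (2 * F))
     + deriv2 \<phi> F + 4 * deriv2 \<phi> (2 * F)"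

definition coeff_B :: "(real \<Rightarrow> real) \<Rightarrow> (real \<Rightarrow> real) \<Rightarrow> (real \<Rightarrow> real) \<Rightarrow> real \<Rightarrow> real" where
  "coeff_B \<phi> \<rho> G F =
     - (deriv2 \<phi> (2 * F)
        + deriv2 G (rho_bar \<rho> F) *
            ((deriv \<rho> F)\<^sup>2 + 20 * (deriv \<rho> (2 * F))\<^sup>2 + 12 * deriv \<rho> F * deriv \<rho> (2 * F))
        + 2 * deriv G (rho_bar \<rho> F) * deriv2 \<rho> (2 * F))"

definition coeff_B_tilde :: "(real \<Rightarrow> real) \<Rightarrow> (real \<Rightarrow> real) \<Rightarrow> real \<Rightarrow> real" where
  "coeff_B_tilde \<rho> G F =
     - deriv2 G (rho_bar \<rho> F) * (deriv \<rho> F + 2 * deriv \<rho> (2 * F))\<^sup>2"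

definition coeff_C :: "(real \<Rightarrow> real) \<Rightarrow> (real \<Rightarrow> real) \<Rightarrow> real \<Rightarrow> real" where
  "coeff_C \<rho> G F =
     deriv2 G (rho_bar \<rho> F) * (8 * (deriv \<rho> (2 * F))\<^sup>2 + 2 * deriv \<rho> F * deriv \<rho> (2 * F))"

definition coeff_D :: "(real \<Rightarrow> real) \<Rightarrow> (real \<Rightarrow> real) \<Rightarrow> real \<Rightarrow> real" where
  "coeff_D \<rho> G F = - deriv2 G (rho_bar \<rho> F) * (deriv \<rho> (2 * F))\<^sup>2"

text \<open>Both eigenvalue functions have the domain \<open>{0..4}\<close>; outside of it their values carry no
  meaning.\<close>

definition lambda_a ::
    "(real \<Rightarrow> real) \<Rightarrow> (real \<Rightarrow> real) \<Rightarrow> (real \<Rightarrow> real) \<Rightarrow> real \<Rightarrow> real \<Rightarrow> real" where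
  "lambda_a \<phi> \<rho> G F s =
     coeff_A \<phi> \<rho> G F + coeff_B \<phi> \<rho> G F * s + coeff_C \<rho> G F * s ^ 2 + coeff_D \<rho> G F * s ^ 3"

definition lambda_cr ::
    "(real \<Rightarrow> real) \<Rightarrow> (real \<Rightarrow> real) \<Rightarrow> (real \<Rightarrow> real) \<Rightarrow> real \<Rightarrow> real \<Rightarrow> real" where
  "lambda_cr \<phi> \<rho> G F s = coeff_A \<phi> \<rho> G F + coeff_B_tilde \<rho> G F * s"

text \<open>The critical point at which the cubic has its local minimum. It is meaningful only for
  \<open>coeff_D \<noteq> 0\<close> and a nonnegative radicand, and it need not lie in \<open>{0..4}\<close>.\<close>

definition s_star :: "(real \<Rightarrow> real) \<Rightarrow> (real \<Rightarrow> real) \<Rightarrow> (real \<Rightarrow> real) \<Rightarrow> real \<Rightarrow> real" where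
  "s_star \<phi> \<rho> G F =
     (coeff_C \<rho> G F - sqrt ((coeff_C \<rho> G F)\<^sup>2 - 3 * coeff_B \<phi> \<rho> G F * coeff_D \<rho> G F))
     / (- 3 * coeff_D \<rho> G F)"

definition minimum_on :: "real set \<Rightarrow> (real \<Rightarrow> real) \<Rightarrow> real" where
  "minimum_on S f = (LEAST m. m \<in> f ` S)"

text \<open>\<open>LEAST\<close> is unspecified if there is no least value; the next three lemmas show that this
  does not happen for the eigenvalue functions on \<open>{0..4}\<close>.\<close>

lemma minimum_on_attained:
  assumes "compact S" "S \<noteq> {}" "continuous_on S f"
  shows "\<exists>t\<in>S. minimum_on S f = f t \<and> (\<forall>s\<in>S. f t \<le> f s)"
proof -
  obtain t where t: "t \<in> S" "\<forall>s\<in>S. f t \<le> f s"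
    using continuous_attains_inf[OF assms] by blast
  have "minimum_on S f = f t"
    unfolding minimum_on_def by (rule Least_equality) (use t in auto)
  with t show ?thesis by blast
qed

lemma continuous_on_lambda_a: "continuous_on S (lambda_a \<phi> \<rho> G F)"
  unfolding lambda_a_def by (intro continuous_intros)

lemma continuous_on_lambda_cr: "continuous_on S (lambda_cr \<phi> \<rho> G F)"
  unfolding lambda_cr_def by (intro continuous_intros)

end

theory Submission
  imports Defs
begin

text \<open>
  Write \<open>h = \<phi>''(2F) + 2 G' \<rho>''(2F)\<close>, \<open>g = G''\<close>, \<open>p = \<rho>'(F)\<close>, \<open>q = \<rho>'(2F)\<close>. Everything rests on the
  factorisation \<open>\<lambda>\<^sup>a(s) - \<lambda>\<^sup>a(4) = (4 - s) (h + g (q (2 - s) + p)\<^sup>2)\<close>, together with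
  \<open>min \<lambda>\<^sup>c\<^sup>r = \<lambda>\<^sup>c\<^sup>r(4) = \<lambda>\<^sup>a(4) + 4 h\<close>. For \<open>h \<ge> 0\<close> the minimum of \<open>\<lambda>\<^sup>a\<close> is thus \<open>\<lambda>\<^sup>a(4)\<close>; for
  \<open>h < 0\<close> the difference \<open>\<lambda>\<^sup>a(s) - \<lambda>\<^sup>c\<^sup>r(4) = (4 - s) g (q (2 - s) + p)\<^sup>2 - h s\<close> is positive
  on \<open>[0, 4]\<close>.
\<close>

lemma minimum_on_eqI:
  assumes "t \<in> S" "\<And>s. s \<in> S \<Longrightarrow> f t \<le> f s"
  shows "minimum_on S f = f t"
  unfolding minimum_on_def by (rule Least_equality) (use assms in auto)

text \<open>An interior minimizer is a root of the quadratic \<open>f'\<close>. Its discriminant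
  makes the square root equal to \<open>f''(t) / 2\<close> once that is known to be nonnegative,
  which fixes the sign in the root formula.\<close>

lemma cubic_interior_minimizer:
  fixes a b c d :: real
  defines "f \<equiv> \<lambda>x. a + b * x + c * x ^ 2 + d * x ^ 3"
  assumes d: "d < 0" and t: "l < t" "t < u" and min: "\<And>x. x \<in> {l..u} \<Longrightarrow> f t \<le> f x"
  shows "t = (c - sqrt (c\<^sup>2 - 3 * b * d)) / (- 3 * d)"
proof -
  have "(f has_real_derivative b + 2 * c * t + 3 * d * t\<^sup>2) (at t)"
    unfolding f_def by (auto intro!: derivative_eq_intros)
  moreover have "\<forall>y. \<bar>t - y\<bar> < min (t - l) (u - t) \<longrightarrow> f t \<le> f y"
    using t by (auto intro!: min)
  ultimately have crit: "b + 2 * c * t + 3 * d * t\<^sup>2 = 0"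
    using t by (intro DERIV_local_min[where d = "min (t - l) (u - t)"]) auto
  \<comment> \<open>Comparing with the right end point already selects the root with \<open>f'' \<ge> 0\<close>.\<close>
  have "f u - f t = (u - t) * (b + 2 * c * t + 3 * d * t\<^sup>2) + (u - t)\<^sup>2 * (c + d * (u + 2 * t))"
    unfolding f_def by algebra
  then have "0 \<le> (u - t)\<^sup>2 * (c + d * (u + 2 * t))"
    using crit min[of u] t by simp
  then have "0 \<le> c + d * (u + 2 * t)"
    using t by (simp add: zero_le_mult_iff)
  \<comment> \<open>\<open>c + d * (u + 2 * t)\<close> is \<open>f''(t) / 2 = c + 3 * d * t\<close>
    plus this negative term.\<close>
  moreover have "d * (u - t) < 0"
    using d t by (simp add: mult_neg_pos)
  ultimately have pos: "0 \<le> c + 3 * d * t"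
    by (simp add: algebra_simps)
  have "c\<^sup>2 - 3 * b * d = (c + 3 * d * t)\<^sup>2"
    using crit by algebra
  then have "sqrt (c\<^sup>2 - 3 * b * d) = c + 3 * d * t"
    using pos by simp
  then show ?thesis
    using d by simp
qed

text \<open>A minimizer is an end point or the interior critical point. Intersecting with
  \<open>{l..u}\<close> discards the value of the root formula when it falls outside. Should it fall
  inside without being critical, it does no harm: \<open>f\<close> there is still at least the
  minimum.\<close>

lemma minimum_on_cubic:
  fixes a b c d :: real
  defines "f \<equiv> \<lambda>x. a + b * x + c * x ^ 2 + d * x ^ 3"
  assumes d: "d < 0" and "l \<le> u"
  shows "minimum_on {l..u} f =
    Min (f ` ({l, (c - sqrt (c\<^sup>2 - 3 * b * d)) / (- 3 * d), u} \<inter> {l..u}))"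
    (is "_ = Min (f ` ?K)")
proof -
  have "continuous_on {l..u} f"
    unfolding f_def by (intro continuous_intros)
  then obtain t where t: "t \<in> {l..u}" "minimum_on {l..u} f = f t" "\<forall>s\<in>{l..u}. f t \<le> f s"
    using minimum_on_attained[of "{l..u}" f] \<open>l \<le> u\<close> by auto
  have "t \<in> ?K"
  proof (cases "t = l \<or> t = u")
    case False
    then have "t = (c - sqrt (c\<^sup>2 - 3 * b * d)) / (- 3 * d)"
      using d t by (intro cubic_interior_minimizer[where a = a and l = l and u = u])
        (auto simp: f_def)
    then show ?thesis
      using t(1) by blast
  qed (use \<open>l \<le> u\<close> in auto)
  then have "Min (f ` ?K) = f t"
    using t(3) by (intro Min_eqI) auto
  then show ?thesis
    using t(2) by simp
qed

lemma minimum_on_lambda_a: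
  assumes "coeff_D \<rho> G F < 0"
  shows "minimum_on {0..4} (lambda_a \<phi> \<rho> G F) =
    Min (lambda_a \<phi> \<rho> G F ` ({0, s_star \<phi> \<rho> G F, 4} \<inter> {0..4}))"
  using minimum_on_cubic[OF assms, of 0 4 "coeff_A \<phi> \<rho> G F" "coeff_B \<phi> \<rho> G F" "coeff_C \<rho> G F"]
  unfolding lambda_a_def[abs_def] s_star_def by simp

lemma lambda_a_diff_4:
  "lambda_a \<phi> \<rho> G F s - lambda_a \<phi> \<rho> G F 4 =
    (4 - s) * (deriv2 \<phi> (2 * F) + 2 * deriv G (rho_bar \<rho> F) * deriv2 \<rho> (2 * F)
      + deriv2 G (rho_bar \<rho> F) * (deriv \<rho> (2 * F) * (2 - s) + deriv \<rho> F)\<^sup>2)"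
  unfolding lambda_a_def coeff_B_def coeff_C_def coeff_D_def by algebra

lemma lambda_cr_4:
  "lambda_cr \<phi> \<rho> G F 4 = lambda_a \<phi> \<rho> G F 4
    + 4 * (deriv2 \<phi> (2 * F) + 2 * deriv G (rho_bar \<rho> F) * deriv2 \<rho> (2 * F))"
  unfolding lambda_cr_def lambda_a_def coeff_B_tilde_def coeff_B_def coeff_C_def coeff_D_def
  by algebra

lemma minimum_on_lambda_cr:
  assumes "deriv2 G (rho_bar \<rho> F) \<ge> 0"
  shows "minimum_on {0..4} (lambda_cr \<phi> \<rho> G F) = lambda_cr \<phi> \<rho> G F 4"
proof (rule minimum_on_eqI)
  fix s :: real
  assume "s \<in> {0..4}"
  moreover have "coeff_B_tilde \<rho> G F \<le> 0"
    using assms by (simp add: coeff_B_tilde_def)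
  ultimately show "lambda_cr \<phi> \<rho> G F 4 \<le> lambda_cr \<phi> \<rho> G F s"
    by (simp add: lambda_cr_def mult_left_mono_neg)
qed simp

lemma minimum_on_lambda_a_eq_4:
  assumes "deriv2 G (rho_bar \<rho> F) \<ge> 0"
    and "deriv2 \<phi> (2 * F) + 2 * deriv G (rho_bar \<rho> F) * deriv2 \<rho> (2 * F) \<ge> 0"
  shows "minimum_on {0..4} (lambda_a \<phi> \<rho> G F) = lambda_a \<phi> \<rho> G F 4"
proof (rule minimum_on_eqI)
  fix s :: real
  assume "s \<in> {0..4}"
  then have "0 \<le> lambda_a \<phi> \<rho> G F s - lambda_a \<phi> \<rho> G F 4"
    unfolding lambda_a_diff_4 using assms by (intro mult_nonneg_nonneg add_nonneg_nonneg[OF assms(2)]) auto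
  then show "lambda_a \<phi> \<rho> G F 4 \<le> lambda_a \<phi> \<rho> G F s"
    by simp
qed simp

lemma lambda_cr_4_less_lambda_a:
  assumes g: "deriv2 G (rho_bar \<rho> F) > 0"
    and pq: "deriv \<rho> F \<le> 0" "deriv \<rho> (2 * F) < 0"
    and h: "deriv2 \<phi> (2 * F) + 2 * deriv G (rho_bar \<rho> F) * deriv2 \<rho> (2 * F) < 0"
    and s: "s \<in> {0..4}"
  shows "lambda_cr \<phi> \<rho> G F 4 < lambda_a \<phi> \<rho> G F s"
proof -
  define h where "h = deriv2 \<phi> (2 * F) + 2 * deriv G (rho_bar \<rho> F) * deriv2 \<rho> (2 * F)"
  define w where "w = deriv2 G (rho_bar \<rho> F) * (deriv \<rho> (2 * F) * (2 - s) + deriv \<rho> F)\<^sup>2"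
  have "lambda_a \<phi> \<rho> G F s - lambda_cr \<phi> \<rho> G F 4 = (4 - s) * (h + w) - 4 * h"
    using lambda_a_diff_4[of \<phi> \<rho> G F s] unfolding lambda_cr_4 h_def w_def by simp
  also have "\<dots> = (4 - s) * w - s * h"
    by (simp add: algebra_simps)
  also have "\<dots> > 0"
  \<comment> \<open>At \<open>s = 0\<close> the term \<open>s * h\<close> vanishes and strictness
    has to come from the square; elsewhere it comes from \<open>h < 0\<close>, even at
    \<open>s = 4\<close>, where the square drops out.\<close>
  proof (cases "s = 0")
    case True
    have "deriv \<rho> (2 * F) * 2 + deriv \<rho> F \<noteq> 0"
      using pq by linarith
    then show ?thesis
      using g True by (simp add: w_def)
  next
    case False
    then have "s * h < 0"
      using s h by (simp add: h_def mult_pos_neg)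
    moreover have "0 \<le> (4 - s) * w"
      using s g by (simp add: w_def)
    ultimately show ?thesis
      by linarith
  qed
  finally show ?thesis
    by simp
qed

theorem theorem5p2:
  fixes \<phi> \<rho> G :: "real \<Rightarrow> real" and F :: real
  assumes "smooth_on_open {0<..} \<phi>" "smooth_on_open {0<..} \<rho>" "smooth_on_open UNIV G"
    and "F > 0"
    and "deriv2 \<phi> F > 0" "deriv2 \<phi> (2 * F) < 0"
    and "deriv \<rho> F \<le> 0" "deriv \<rho> (2 * F) \<le> 0"
    and "deriv2 \<rho> F \<ge> 0" "deriv2 \<rho> (2 * F) \<ge> 0"
    and "deriv2 G (rho_bar \<rho> F) \<ge> 0"
    and "coeff_C \<rho> G F > 0" "coeff_D \<rho> G F < 0"
  shows "(deriv2 \<phi> (2 * F) + 2 * deriv G (rho_bar \<rho> F) * deriv2 \<rho> (2 * F) > 0 \<longrightarrow>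
           minimum_on {0..4} (lambda_a \<phi> \<rho> G F) = lambda_a \<phi> \<rho> G F 4 \<and>
           lambda_a \<phi> \<rho> G F 4 < minimum_on {0..4} (lambda_cr \<phi> \<rho> G F)) \<and>
         (deriv2 \<phi> (2 * F) + 2 * deriv G (rho_bar \<rho> F) * deriv2 \<rho> (2 * F) = 0 \<longrightarrow>
           minimum_on {0..4} (lambda_a \<phi> \<rho> G F) =
             Min (lambda_a \<phi> \<rho> G F ` ({0, s_star \<phi> \<rho> G F, 4} \<inter> {0..4})) \<and>
           Min (lambda_a \<phi> \<rho> G F ` ({0, s_star \<phi> \<rho> G F, 4} \<inter> {0..4})) =
             minimum_on {0..4} (lambda_cr \<phi> \<rho> G F)) \<and>
         (deriv2 \<phi> (2 * F) + 2 * deriv G (rho_bar \<rho> F) * deriv2 \<rho> (2 * F) < 0 \<longrightarrow>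
           minimum_on {0..4} (lambda_a \<phi> \<rho> G F) =
             Min (lambda_a \<phi> \<rho> G F ` ({0, s_star \<phi> \<rho> G F, 4} \<inter> {0..4})) \<and>
           Min (lambda_a \<phi> \<rho> G F ` ({0, s_star \<phi> \<rho> G F, 4} \<inter> {0..4})) >
             minimum_on {0..4} (lambda_cr \<phi> \<rho> G F))"
proof -
  \<comment> \<open>\<open>coeff_D \<rho> G F < 0\<close> excludes the degenerate cases of the weak
    sign assumptions.\<close>
  have g: "deriv2 G (rho_bar \<rho> F) > 0" and "deriv \<rho> (2 * F) \<noteq> 0"
    using assms(11,13) by (auto simp: coeff_D_def zero_less_mult_iff)
  then have q: "deriv \<rho> (2 * F) < 0"
    using assms(8) by simp
  have "continuous_on {0..4} (lambda_a \<phi> \<rho> G F)"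
    by (rule continuous_on_lambda_a)
  \<comment> \<open>Attainment lets the strict pointwise bound pass to the minimum.\<close>
  then obtain t where "t \<in> {0..4}" "minimum_on {0..4} (lambda_a \<phi> \<rho> G F) = lambda_a \<phi> \<rho> G F t"
    using minimum_on_attained[of "{0..4}" "lambda_a \<phi> \<rho> G F"] by auto
  then have "minimum_on {0..4} (lambda_cr \<phi> \<rho> G F) < minimum_on {0..4} (lambda_a \<phi> \<rho> G F)"
    if "deriv2 \<phi> (2 * F) + 2 * deriv G (rho_bar \<rho> F) * deriv2 \<rho> (2 * F) < 0"
    using lambda_cr_4_less_lambda_a[OF g assms(7) q that] minimum_on_lambda_cr[OF assms(11)]
    by simp
  then show ?thesis
    \<comment> \<open>Folding each \<open>Min\<close> back into \<open>minimum_on\<close> leaves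
      only comparisons of the two minima, whose gap is \<open>4 * h\<close> when
      \<open>h \<ge> 0\<close>.\<close>
    using minimum_on_lambda_a_eq_4[OF assms(11), of \<phi>]
    unfolding minimum_on_lambda_a[OF assms(13), symmetric] minimum_on_lambda_cr[OF assms(11)]
      lambda_cr_4
    by auto
qed

end
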